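(* Let $1\le\delta<\Delta$ be integers, let $\tilde h:\mathbb{Z}^+\to\mathbb{R}^+$ be a positive non-increasing function, $\mathcal{J}(G)=\sum_{u\in V(G)}\tilde h(d_u)$, and let $G$ be a graph with minimum degree $\delta$ and maximum degree $\Delta$. Then: (i) if $\delta$ is even, $\mathcal{J}(G)\ge\min\{\delta\tilde h(\Delta)+(\Delta-\delta)\tilde h(\Delta-1)+\tilde h(\delta),\ (\Delta+1)\tilde h(\Delta)+\tilde h(\delta)\}$; (ii) if either $\delta$ is odd and $\Delta$ is even, or $\delta\Delta$ is odd and $2\tilde h(\Delta)>\tilde h(\Delta-1)$, then $\mathcal{J}(G)\ge\min\{\delta\tilde h(\Delta)+(\Delta-\delta)\tilde h(\Delta-1)+\tilde h(\delta),\ \Delta\tilde h(\Delta)+\tilde h(\Delta-1)+\tilde h(\delta)\}$; (iii) if $\delta\Delta$ is odd and $2\tilde h(\Delta)\le\tilde h(\Delta-1)$, then $\mathcal{J}(G)\ge\min\{\delta\tilde h(\Delta)+(\Delta-\delta)\tilde h(\Delta-1)+\tilde h(\delta),\ (\Delta+2)\tilde h(\Delta)+\tilde h(\delta)\}$.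
   Context: All graphs are finite, simple and have at least one edge; $d_u$ denotes the degree of vertex $u$. *)

theory Defs
  imports Complex_Main
begin

text \<open>Finite simple graphs with at least one edge.
  Edges are two-element sets of vertices, so loops and multiple edges are excluded.\<close>

locale simple_graph =
  fixes V :: "'a set" and E :: "'a set set"
  assumes finite_vertices: "finite V"
    and edges: "e \<in> E \<Longrightarrow> e \<subseteq> V \<and> card e = 2"
    and has_edge: "E \<noteq> {}"

definition degree :: "'a set set \<Rightarrow> 'a \<Rightarrow> nat"
  where "degree E u = card {e \<in> E. u \<in> e}"

text \<open>\<^const>\<open>Min\<close> and \<^const>\<open>Max\<close> are only meaningful on finite nonempty sets;
  here \<open>V\<close> is nonempty because the graph has an edge.\<close>

definition min_degree :: "'a set \<Rightarrow> 'a set set \<Rightarrow> nat"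
  where "min_degree V E = Min (degree E ` V)"

definition max_degree :: "'a set \<Rightarrow> 'a set set \<Rightarrow> nat"
  where "max_degree V E = Max (degree E ` V)"

definition degree_index :: "(nat \<Rightarrow> real) \<Rightarrow> 'a set \<Rightarrow> 'a set set \<Rightarrow> real"
  where "degree_index h V E = (\<Sum>u\<in>V. h (degree E u))"

end

theory Submission imports Defs begin

text \<open>Let \<open>w\<close> have degree \<open>\<delta>\<close> and let \<open>n\<close> be the order of the graph, so \<open>n \<ge> \<Delta> + 1\<close>. If \<open>n = \<Delta> + 1\<close>, then
  the \<open>\<Delta> - \<delta>\<close> vertices not adjacent to \<open>w\<close> have degree at most \<open>\<Delta> - 1\<close>, which gives the first
  entry of the minimum. If \<open>n \<ge> \<Delta> + 2\<close>, then \<open>w\<close> contributes \<open>h \<delta>\<close> and every other vertex at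
  least \<open>h \<Delta>\<close>. When \<open>\<delta>\<close> is odd and either \<open>\<Delta>\<close> is even or \<open>n = \<Delta> + 2\<close>, the handshake lemma
  forbids that all vertices other than \<open>w\<close> have degree \<open>\<Delta>\<close>, so one of them contributes at least
  \<open>h (\<Delta> - 1)\<close>.\<close>

context simple_graph
begin

lemma finite_edges: "finite E"
  by (rule finite_subset[of _ "Pow V"]) (use edges finite_vertices in auto)

text \<open>Double counting of the incident pairs: each edge is a two-element subset of
  \<open>V\<close>.\<close>

lemma sum_degree: "(\<Sum>u\<in>V. degree E u) = 2 * card E"
proof -
  have "card {u \<in> V. u \<in> e} = 2" if "e \<in> E" for e
  proof -
    have "{u \<in> V. u \<in> e} = e" using edges[OF that] by auto
    then show ?thesis using edges[OF that] by simp
  qed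
  then have "(\<Sum>u\<in>V. card {e \<in> E. u \<in> e}) = (\<Sum>e\<in>E. 2)"
    by (intro sum_multicount_gen finite_vertices finite_edges) auto
  then show ?thesis by (simp add: degree_def)
qed

lemma neighbours_subset: "{v. {u, v} \<in> E} \<subseteq> V - {u}"
  using edges by fastforce

text \<open>An edge through \<open>u\<close> is determined by its other end. Degrees thus become
  sizes of subsets of \<open>V\<close>, comparable with the order.\<close>

lemma degree_eq_card_neighbours: "degree E u = card {v. {u, v} \<in> E}"
proof -
  have "bij_betw (\<lambda>v. {u, v}) {v. {u, v} \<in> E} {e \<in> E. u \<in> e}"
  proof (rule bij_betw_imageI)
    show "inj_on (\<lambda>v. {u, v}) {v. {u, v} \<in> E}"
      by (auto simp: inj_on_def doubleton_eq_iff)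
    have "e \<in> (\<lambda>v. {u, v}) ` {v. {u, v} \<in> E}" if e: "e \<in> E" "u \<in> e" for e
    proof -
      obtain v where "e = {u, v}"
        using edges[OF e(1)] e(2) by (auto simp: card_2_iff)
      then show ?thesis using e by auto
    qed
    then show "(\<lambda>v. {u, v}) ` {v. {u, v} \<in> E} = {e \<in> E. u \<in> e}"
      by auto
  qed
  then show ?thesis by (simp add: degree_def bij_betw_same_card)
qed

lemma degree_less_order: "u \<in> V \<Longrightarrow> degree E u < card V"
  unfolding degree_eq_card_neighbours
  by (intro psubset_card_mono finite_vertices) (use neighbours_subset[of u] in auto)

text \<open>The neighbours of \<open>u\<close> avoid both \<open>u\<close> and \<open>v\<close>. For
  order \<Delta> + 1 this keeps the non-neighbours of a vertex below degree \<Delta>.\<close>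

lemma degree_nonadjacent:
  assumes "u \<in> V" "v \<in> V" "u \<noteq> v" "{u, v} \<notin> E"
  shows "degree E u + 2 \<le> card V"
proof -
  have "{x. {u, x} \<in> E} \<subseteq> V - {u, v}"
    using neighbours_subset[of u] assms(4) by auto
  then have "degree E u \<le> card (V - {u, v})"
    unfolding degree_eq_card_neighbours by (intro card_mono) (simp_all add: finite_vertices)
  moreover have "card (V - {u, v}) = card V - 2"
    using assms by (simp add: card_Diff_subset)
  \<comment> \<open>Ensures that the natural subtraction \<open>card V - 2\<close> is not
    truncated.\<close>
  moreover have "card {u, v} \<le> card V"
    by (intro card_mono finite_vertices) (use assms in auto)
  ultimately show ?thesis using assms(3) by simp
qed

lemma vertices_nonempty: "V \<noteq> {}"
  using has_edge edges by fastforce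

lemma min_degree_attained: "\<exists>u\<in>V. degree E u = min_degree V E"
  unfolding min_degree_def
  using Min_in[of "degree E ` V"] finite_vertices vertices_nonempty
  by (metis finite_imageI image_is_empty imageE)

lemma max_degree_attained: "\<exists>u\<in>V. degree E u = max_degree V E"
  unfolding max_degree_def
  using Max_in[of "degree E ` V"] finite_vertices vertices_nonempty
  by (metis finite_imageI image_is_empty imageE)

lemma min_degree_le: "u \<in> V \<Longrightarrow> min_degree V E \<le> degree E u"
  using finite_vertices by (simp add: min_degree_def)

lemma degree_le_max: "u \<in> V \<Longrightarrow> degree E u \<le> max_degree V E"
  using finite_vertices by (simp add: max_degree_def)

lemma max_degree_less_order: "max_degree V E < card V"
  using max_degree_attained degree_less_order by metis

text \<open>If all other vertices had degree \<open>d\<close>, the degree sum would be this odd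
  number, against the handshake lemma.\<close>

lemma exists_other_degree:
  assumes "w \<in> V" "odd (degree E w + (card V - 1) * d)"
  shows "\<exists>v\<in>V - {w}. degree E v \<noteq> d"
proof (rule ccontr)
  assume "\<not> ?thesis"
  then have "(\<Sum>u\<in>V - {w}. degree E u) = (card V - 1) * d"
    using assms(1) by simp
  then have "degree E w + (card V - 1) * d = 2 * card E"
    using sum_degree sum.remove[OF finite_vertices assms(1), of "degree E"] by simp
  then show False using assms(2) by simp
qed

lemma degree_index_remove:
  "w \<in> V \<Longrightarrow> degree_index h V E = h (degree E w) + (\<Sum>u\<in>V - {w}. h (degree E u))"
  unfolding degree_index_def by (rule sum.remove[OF finite_vertices])

lemma degree_index_ge_one:
  assumes "w \<in> V" "\<And>u. u \<in> V \<Longrightarrow> x \<le> h (degree E u)"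
  shows "h (degree E w) + (real (card V) - 1) * x \<le> degree_index h V E"
proof -
  have "card V \<ge> 1"
    using degree_less_order[OF assms(1)] by simp
  then have "(real (card V) - 1) * x = of_nat (card (V - {w})) * x"
    using assms(1) by (simp add: of_nat_diff)
  also have "\<dots> \<le> (\<Sum>u\<in>V - {w}. h (degree E u))"
    using assms(2) by (intro sum_bounded_below) auto
  finally show ?thesis by (simp add: degree_index_remove[OF assms(1)])
qed

lemma degree_index_ge_two:
  assumes "w \<in> V" "v \<in> V - {w}" "\<And>u. u \<in> V \<Longrightarrow> x \<le> h (degree E u)"
  shows "h (degree E w) + h (degree E v) + (real (card V) - 2) * x \<le> degree_index h V E"
proof -
  have "card {v, w} \<le> card V"
    by (intro card_mono finite_vertices) (use assms in auto)
  then have "card V \<ge> 2" using assms(2) by simp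
  then have "(real (card V) - 2) * x = of_nat (card (V - {w} - {v})) * x"
    using assms(1,2) by (simp add: of_nat_diff)
  also have "\<dots> \<le> (\<Sum>u\<in>V - {w} - {v}. h (degree E u))"
    using assms(3) by (intro sum_bounded_below) auto
  finally show ?thesis
    using sum.remove[of "V - {w}" v "\<lambda>u. h (degree E u)"] finite_vertices assms(2)
    by (simp add: degree_index_remove[OF assms(1)])
qed

text \<open>Splits \<open>V - {w}\<close> into the neighbours of \<open>w\<close>, each contributing
  at least \<open>x\<close>, and the non-neighbours, each contributing at least \<open>y\<close> by
  \<open>degree_nonadjacent\<close>.\<close>

lemma degree_index_ge_neighbourhood:
  assumes w: "w \<in> V"
    and x: "\<And>u. u \<in> V \<Longrightarrow> x \<le> h (degree E u)"
    and y: "\<And>u. u \<in> V \<Longrightarrow> degree E u + 2 \<le> card V \<Longrightarrow> y \<le> h (degree E u)"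
  shows "h (degree E w) + real (degree E w) * x + (real (card V) - 1 - real (degree E w)) * y
    \<le> degree_index h V E"
proof -
  define N where "N = {v. {w, v} \<in> E}"
  have N: "N \<subseteq> V - {w}" "card N = degree E w"
    using neighbours_subset[of w] by (simp_all add: N_def degree_eq_card_neighbours)
  then have fin: "finite N" using finite_vertices by (meson finite_Diff finite_subset)
  have "card (V - {w} - N) = card V - 1 - degree E w"
    using N w fin by (simp add: card_Diff_subset)
  then have "real (card V) - 1 - real (degree E w) = of_nat (card (V - {w} - N))"
    using degree_less_order[OF w] by (simp add: of_nat_diff)
  moreover have "of_nat (card (V - {w} - N)) * y \<le> (\<Sum>u\<in>V - {w} - N. h (degree E u))"
  proof (rule sum_bounded_below)
    fix u assume u: "u \<in> V - {w} - N"
    then have "{u, w} \<notin> E" by (simp add: N_def insert_commute)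
    then show "y \<le> h (degree E u)"
      using u w by (intro y degree_nonadjacent[of u w]) auto
  qed
  moreover have "of_nat (card N) * x \<le> (\<Sum>u\<in>N. h (degree E u))"
    using N(1) by (intro sum_bounded_below x) auto
  moreover have "(\<Sum>u\<in>V - {w}. h (degree E u)) =
      (\<Sum>u\<in>V - {w} - N. h (degree E u)) + (\<Sum>u\<in>N. h (degree E u))"
    using N(1) finite_vertices by (intro sum.subset_diff) auto
  ultimately show ?thesis
    by (simp add: degree_index_remove[OF w] N(2))
qed

end

theorem theorem2p17:
  fixes \<delta> \<Delta> :: nat and h :: "nat \<Rightarrow> real"
    and V :: "'a set" and E :: "'a set set"
  assumes "1 \<le> \<delta>" and "\<delta> < \<Delta>"
    and "\<And>k. 1 \<le> k \<Longrightarrow> 0 < h k"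
    and "antimono_on {1..} h"
    and "simple_graph V E"
    and "min_degree V E = \<delta>" and "max_degree V E = \<Delta>"
  shows
    "(even \<delta> \<longrightarrow>
        degree_index h V E \<ge>
          min (real \<delta> * h \<Delta> + (real \<Delta> - real \<delta>) * h (\<Delta> - 1) + h \<delta>)
              ((real \<Delta> + 1) * h \<Delta> + h \<delta>)) \<and>
     ((odd \<delta> \<and> even \<Delta>) \<or> (odd (\<delta> * \<Delta>) \<and> 2 * h \<Delta> > h (\<Delta> - 1)) \<longrightarrow>
        degree_index h V E \<ge>
          min (real \<delta> * h \<Delta> + (real \<Delta> - real \<delta>) * h (\<Delta> - 1) + h \<delta>)
              (real \<Delta> * h \<Delta> + h (\<Delta> - 1) + h \<delta>)) \<and>
     (odd (\<delta> * \<Delta>) \<and> 2 * h \<Delta> \<le> h (\<Delta> - 1) \<longrightarrow>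
        degree_index h V E \<ge>
          min (real \<delta> * h \<Delta> + (real \<Delta> - real \<delta>) * h (\<Delta> - 1) + h \<delta>)
              ((real \<Delta> + 2) * h \<Delta> + h \<delta>))"
proof -
  interpret simple_graph V E by fact
  let ?J = "degree_index h V E" and ?n = "card V"
  obtain w where w: "w \<in> V" and dw: "degree E w = \<delta>"
    using min_degree_attained assms(6) by auto
  have deg: "\<delta> \<le> degree E u" "degree E u \<le> \<Delta>" if "u \<in> V" for u
    using min_degree_le[OF that] degree_le_max[OF that] assms(6,7) by auto
  have mono: "h b \<le> h a" if "1 \<le> a" "a \<le> b" for a b
    using monotone_onD[OF assms(4)] that by auto
  have x: "h \<Delta> \<le> h (degree E u)" if "u \<in> V" for u
    using deg[OF that] assms(1) by (intro mono) auto
  have y: "h (\<Delta> - 1) \<le> h (degree E u)" if "u \<in> V" "degree E u < \<Delta>" for u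
    using deg[OF that(1)] that(2) assms(1) by (intro mono) auto
  have pos: "0 < h \<Delta>"
    using assms(1,2) by (auto intro: assms(3))
  have order: "\<Delta> < ?n"
    using max_degree_less_order assms(7) by simp
  have small: "real \<delta> * h \<Delta> + (real \<Delta> - real \<delta>) * h (\<Delta> - 1) + h \<delta> \<le> ?J" if "?n = \<Delta> + 1"
    using degree_index_ge_neighbourhood[of w "h \<Delta>" h "h (\<Delta> - 1)"] w x y that
    by (simp add: dw)
  \<comment> \<open>At least \<Delta> + \<open>k\<close> vertices remain besides \<open>w\<close>;
    surplus ones may be dropped because \<open>h \<Delta>\<close> is positive.\<close>
  have one: "(real \<Delta> + real k) * h \<Delta> + h \<delta> \<le> ?J" if "\<Delta> + k + 1 \<le> ?n" for k
  proof -
    have "(real \<Delta> + real k) * h \<Delta> \<le> (real ?n - 1) * h \<Delta>"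
      using that pos by (intro mult_right_mono) auto
    then show ?thesis
      using degree_index_ge_one[of w "h \<Delta>" h] w x by (simp add: dw)
  qed
  have two: "real \<Delta> * h \<Delta> + h (\<Delta> - 1) + h \<delta> \<le> ?J"
    if n: "\<Delta> + 2 \<le> ?n" and odd: "odd (\<delta> + (?n - 1) * \<Delta>)"
  proof -
    obtain v where v: "v \<in> V - {w}" "degree E v \<noteq> \<Delta>"
      using exists_other_degree[OF w] odd dw by auto
    then have "h (\<Delta> - 1) \<le> h (degree E v)"
      using deg[of v] by (intro y) auto
    moreover have "real \<Delta> * h \<Delta> \<le> (real ?n - 2) * h \<Delta>"
      using n pos by (intro mult_right_mono) auto
    ultimately show ?thesis
      using degree_index_ge_two[of w v "h \<Delta>" h] w v x by (simp add: dw)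
  qed
  \<comment> \<open>For order \<Delta> + 2 the product is (\<Delta> + 1) \<Delta>, even for every
    \<Delta>.\<close>
  have parity: "odd (\<delta> + (?n - 1) * \<Delta>)" if "odd \<delta>" "even \<Delta> \<or> ?n = \<Delta> + 2"
    using that by auto
  consider "?n = \<Delta> + 1" | "?n = \<Delta> + 2" | "\<Delta> + 3 \<le> ?n"
    using order by linarith
  then show ?thesis
  proof cases
    case 1
    then show ?thesis using small min.coboundedI1 by blast
  next
    case 2
    have "real \<Delta> * h \<Delta> + h (\<Delta> - 1) + h \<delta> \<le> ?J" if "odd \<delta>"
      using two parity that 2 by simp
    moreover have "(real \<Delta> + 1) * h \<Delta> + h \<delta> \<le> ?J"
      using one[of 1] 2 by simp
    \<comment> \<open>In the third claim, \<open>2 * h \<Delta> \<le> h (\<Delta> - 1)\<close> lets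
      the term \<open>h (\<Delta> - 1)\<close> of the first bound pay for two copies of
      \<open>h \<Delta>\<close>.\<close>
    ultimately show ?thesis by (auto simp: min_le_iff_disj algebra_simps)
  next
    case 3
    have "real \<Delta> * h \<Delta> + h (\<Delta> - 1) + h \<delta> \<le> ?J" if "odd \<delta>" "even \<Delta>"
      using two parity that 3 by simp
    moreover have "(real \<Delta> + 1) * h \<Delta> + h \<delta> \<le> ?J" "(real \<Delta> + 2) * h \<Delta> + h \<delta> \<le> ?J"
      using one[of 1] one[of 2] 3 by simp_all
    \<comment> \<open>When \<delta> and \<Delta> are both odd, parity need not help, but \<Delta> +
      2 other vertices exist. Their bound is the one of the third claim, and it implies that of the
      second if \<open>2 * h \<Delta> > h (\<Delta> - 1)\<close>.\<close>
    ultimately show ?thesis by (auto simp: min_le_iff_disj algebra_simps)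
  qed
qed

end
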